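(* Let $n\geq 2$ and let $\alpha$ be an interval $W(Q_n)$-coloring of $Q_n$. Then for every $k$ with $1\leq k\leq n-1$, $$\mathrm{sp}_{\alpha,k}\leq \mathrm{sp}_{\alpha,k-1}+n-k.$$
   Context: All graphs are finite, undirected, without loops or multiple edges. An edge-coloring of a graph $G$ with colors $1,\ldots,t$ is an interval $t$-coloring if all $t$ colors are used, and the colors of the edges incident to each vertex are distinct and form an interval of consecutive integers; $W(G)$ is the greatest $t$ for which $G$ has an interval $t$-coloring. $Q_n$ is the $n$-dimensional hypercube (Cartesian product of $n$ copies of $K_2$), and $d(u,v)$ is the graph distance. For edges $e=u_1u_2$ and $e'=v_1v_2$ of $Q_n$, $d(e,e')=\min_{1\leq i,j\leq 2}d(u_i,v_j)$. For an interval coloring $\alpha$ of $Q_n$, $\mathrm{sp}_\alpha(e,e')=|\alpha(e)-\alpha(e')|$, and for $0\leq k\leq n-1$, $\mathrm{sp}_{\alpha,k}=\max\{\mathrm{sp}_\alpha(e,e')\colon e,e'\in E(Q_n),\ d(e,e')=k\}$. *)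

theory Defs
  imports "HOL-Library.FuncSet" "HOL-Library.Extended_Nat"
begin

record 'a graph =
  verts :: "'a set"
  edges :: "'a set set"

text \<open>Loops would appear as singletons in the edge set; the graphs built below have none.\<close>

definition K2 :: "bool graph" where
  "K2 = \<lparr>verts = UNIV, edges = {{False, True}}\<rparr>"

definition cartesian_product :: "'i set \<Rightarrow> ('i \<Rightarrow> 'a graph) \<Rightarrow> ('i \<Rightarrow> 'a) graph" where
  "cartesian_product I G =
    \<lparr>verts = (\<Pi>\<^sub>E i\<in>I. verts (G i)),
     edges = {{f, g} | f g. f \<in> (\<Pi>\<^sub>E i\<in>I. verts (G i)) \<and> g \<in> (\<Pi>\<^sub>E i\<in>I. verts (G i)) \<and>
       (\<exists>i\<in>I. {f i, g i} \<in> edges (G i) \<and> (\<forall>j\<in>I - {i}. f j = g j))}\<rparr>"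

definition hypercube :: "nat \<Rightarrow> (nat \<Rightarrow> bool) graph" where
  "hypercube n = cartesian_product {..<n} (\<lambda>_. K2)"

definition incident_edges :: "'a graph \<Rightarrow> 'a \<Rightarrow> 'a set set" where
  "incident_edges G v = {e \<in> edges G. v \<in> e}"

definition interval_coloring :: "'a graph \<Rightarrow> nat \<Rightarrow> ('a set \<Rightarrow> nat) \<Rightarrow> bool" where
  "interval_coloring G t \<alpha> \<longleftrightarrow>
    \<alpha> ` edges G = {1..t} \<and>
    (\<forall>v\<in>verts G. inj_on \<alpha> (incident_edges G v) \<and>
      (\<exists>a b. \<alpha> ` incident_edges G v = {a..b}))"

text \<open>
  For a finite graph, \<open>t\<close> is bounded by the number of edges, so the greatest \<open>t\<close> exists
  as soon as the graph has some interval coloring.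
\<close>

definition W :: "'a graph \<Rightarrow> nat" where
  "W G = (GREATEST t. \<exists>\<alpha>. interval_coloring G t \<alpha>)"

definition walk :: "'a graph \<Rightarrow> 'a \<Rightarrow> 'a list \<Rightarrow> 'a \<Rightarrow> bool" where
  "walk G u p v \<longleftrightarrow> p \<noteq> [] \<and> hd p = u \<and> last p = v \<and> set p \<subseteq> verts G \<and>
    (\<forall>i. Suc i < length p \<longrightarrow> {p ! i, p ! Suc i} \<in> edges G)"

text \<open>The distance is \<open>\<infinity>\<close> for vertices in different components.\<close>

definition graph_dist :: "'a graph \<Rightarrow> 'a \<Rightarrow> 'a \<Rightarrow> enat" where
  "graph_dist G u v = (INF p\<in>{p. walk G u p v}. enat (length p - 1))"

definition edge_dist :: "'a graph \<Rightarrow> 'a set \<Rightarrow> 'a set \<Rightarrow> enat" where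
  "edge_dist G e e' = Min {graph_dist G u v | u v. u \<in> e \<and> v \<in> e'}"

definition spread :: "('a set \<Rightarrow> nat) \<Rightarrow> 'a set \<Rightarrow> 'a set \<Rightarrow> int" where
  "spread \<alpha> e e' = \<bar>int (\<alpha> e) - int (\<alpha> e')\<bar>"

definition max_spread :: "'a graph \<Rightarrow> ('a set \<Rightarrow> nat) \<Rightarrow> nat \<Rightarrow> int" where
  "max_spread G \<alpha> k =
    Max {spread \<alpha> e e' | e e'. e \<in> edges G \<and> e' \<in> edges G \<and> edge_dist G e e' = enat k}"

end

theory Submission
  imports Defs
begin

text \<open>
  Let \<open>d(e, e') = k\<close> be realised by \<open>u \<in> e\<close> and \<open>v \<in> e'\<close>. Since \<open>u\<close> and \<open>v\<close> differ in exactly \<open>k\<close>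
  coordinates, \<open>k\<close> of the \<open>n\<close> edges at \<open>v\<close> lead towards \<open>u\<close>, and each of these lies at distance
  \<open>k - 1\<close> from \<open>e\<close>. The \<open>n\<close> colors at \<open>v\<close> are consecutive, so the largest of the \<open>k\<close> colors of these
  edges is at least \<open>\<alpha>(e') - (n - k)\<close> and the smallest is at most \<open>\<alpha>(e') + (n - k)\<close>. Comparing
  \<open>\<alpha>(e)\<close> with the appropriate one gives the bound.
\<close>

section \<open>Coordinate flips and the edges of the hypercube\<close>

definition flip :: "nat \<Rightarrow> (nat \<Rightarrow> bool) \<Rightarrow> nat \<Rightarrow> bool" where
  "flip i u = u(i := \<not> u i)"

definition hamming :: "nat \<Rightarrow> (nat \<Rightarrow> bool) \<Rightarrow> (nat \<Rightarrow> bool) \<Rightarrow> nat" where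
  "hamming n u v = card {i. i < n \<and> u i \<noteq> v i}"

lemma flip_in_verts:
  assumes "u \<in> verts (hypercube n)" "i < n"
  shows "flip i u \<in> verts (hypercube n)"
  using assms
  by (auto simp: hypercube_def cartesian_product_def flip_def K2_def PiE_def extensional_def)

lemma finite_verts_hypercube: "finite (verts (hypercube n))"
  by (simp add: hypercube_def cartesian_product_def K2_def finite_PiE)

lemma edges_hypercube:
  "edges (hypercube n) = {{u, flip i u} | u i. u \<in> verts (hypercube n) \<and> i < n}"
proof (intro set_eqI iffI)
  fix e
  assume "e \<in> edges (hypercube n)"
  then obtain f g i where e: "e = {f, g}" and f: "f \<in> verts (hypercube n)"
    and g: "g \<in> verts (hypercube n)" and i: "i < n" and d: "{f i, g i} = {False, True}"
    and eq: "\<forall>j\<in>{..<n} - {i}. f j = g j"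
    by (auto simp: hypercube_def cartesian_product_def K2_def)
  have "g j = flip i f j" for j
  proof (cases "j < n")
    case True
    then show ?thesis
      using d eq by (auto simp: flip_def doubleton_eq_iff)
  next
    \<comment> \<open>Outside the index set both functions are \<open>undefined\<close>, so they
      agree as total functions.\<close>
    case False
    then show ?thesis
      using f g i by (auto simp: flip_def hypercube_def cartesian_product_def PiE_def extensional_def)
  qed
  then have "g = flip i f" by blast
  then show "e \<in> {{u, flip i u} | u i. u \<in> verts (hypercube n) \<and> i < n}"
    using e f i by blast
next
  fix e
  assume "e \<in> {{u, flip i u} | u i. u \<in> verts (hypercube n) \<and> i < n}"
  then obtain u i where e: "e = {u, flip i u}" and u: "u \<in> verts (hypercube n)" and i: "i < n"
    by blast
  have "{u i, flip i u i} = {False, True}" "\<forall>j\<in>{..<n} - {i}. u j = flip i u j"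
    by (auto simp: flip_def)
  then show "e \<in> edges (hypercube n)"
    using e u i flip_in_verts[OF u i]
    by (auto simp: hypercube_def cartesian_product_def K2_def)
qed

lemma finite_edges_hypercube: "finite (edges (hypercube n))"
proof (rule finite_subset)
  show "edges (hypercube n) \<subseteq> Pow (verts (hypercube n))"
    using flip_in_verts by (auto simp: edges_hypercube)
  show "finite (Pow (verts (hypercube n)))"
    by (simp add: finite_verts_hypercube)
qed

lemma flip_flip [simp]: "flip i (flip i u) = u"
  by (auto simp: flip_def)

lemma flip_eq_iff: "flip i u = flip j u \<longleftrightarrow> i = j"
  by (metis flip_def fun_upd_apply)

lemma incident_edges_hypercube:
  assumes "v \<in> verts (hypercube n)"
  shows "incident_edges (hypercube n) v = (\<lambda>i. {v, flip i v}) ` {..<n}"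
proof (intro set_eqI iffI)
  fix e
  assume "e \<in> incident_edges (hypercube n) v"
  then obtain u i where "e = {u, flip i u}" "i < n" "v = u \<or> v = flip i u"
    by (auto simp: incident_edges_def edges_hypercube)
  then show "e \<in> (\<lambda>i. {v, flip i v}) ` {..<n}"
    by (auto intro!: image_eqI[of _ _ i])
next
  fix e
  assume "e \<in> (\<lambda>i. {v, flip i v}) ` {..<n}"
  then show "e \<in> incident_edges (hypercube n) v"
    using assms by (auto simp: incident_edges_def edges_hypercube)
qed

lemma inj_flip_edge: "inj_on (\<lambda>i. {v, flip i v}) A"
  by (rule inj_onI) (metis doubleton_eq_iff flip_eq_iff)

lemma card_incident_edges_hypercube:
  assumes "v \<in> verts (hypercube n)"
  shows "card (incident_edges (hypercube n) v) = n"
  by (simp add: incident_edges_hypercube[OF assms] card_image inj_flip_edge)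

section \<open>Hamming distance as graph distance\<close>

lemma hamming_commute: "hamming n u v = hamming n v u"
  unfolding hamming_def by metis

lemma hamming_flip_le: "hamming n u v \<le> Suc (hamming n u (flip i v))"
proof -
  have "{j. j < n \<and> u j \<noteq> v j} \<subseteq> insert i {j. j < n \<and> u j \<noteq> flip i v j}"
    by (auto simp: flip_def)
  then have "hamming n u v \<le> card (insert i {j. j < n \<and> u j \<noteq> flip i v j})"
    unfolding hamming_def by (intro card_mono) auto
  also have "\<dots> \<le> Suc (hamming n u (flip i v))"
    unfolding hamming_def by (rule card_insert_le_m1) auto
  finally show ?thesis .
qed

lemma hamming_flip:
  assumes "i < n" "u i \<noteq> v i"
  shows "hamming n u v = Suc (hamming n u (flip i v))"
proof -
  have "{j. j < n \<and> u j \<noteq> v j} = insert i {j. j < n \<and> u j \<noteq> flip i v j}"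
    using assms by (auto simp: flip_def)
  then show ?thesis
    using assms by (simp add: hamming_def flip_def)
qed

text \<open>Each step of a walk flips one coordinate, so after \<open>j\<close> steps at most
  \<open>j\<close> coordinates differ from those of \<open>u\<close>.\<close>

lemma hamming_le_walk:
  assumes "walk (hypercube n) u p v"
  shows "hamming n u v \<le> length p - 1"
proof -
  have "hamming n u (p ! j) \<le> j" if "j < length p" for j
    using that
  proof (induction j)
    case 0
    then show ?case
      using assms by (simp add: walk_def hd_conv_nth hamming_def)
  next
    case (Suc j)
    then have "{p ! j, p ! Suc j} \<in> edges (hypercube n)"
      using assms by (simp add: walk_def)
    then obtain i where "p ! j = flip i (p ! Suc j)"
      by (auto simp: edges_hypercube doubleton_eq_iff) (metis flip_flip)
    then show ?case
      using Suc hamming_flip_le[of n u "p ! Suc j" i] by simp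
  qed
  from this[of "length p - 1"] show ?thesis
    using assms by (auto simp: walk_def last_conv_nth)
qed

text \<open>Correcting the differing coordinates one at a time gives the walk. The length of
  \<open>p\<close> counts vertices, hence the \<open>Suc\<close>.\<close>

lemma ex_walk_hamming:
  assumes "u \<in> verts (hypercube n)" "v \<in> verts (hypercube n)"
  shows "\<exists>p. walk (hypercube n) u p v \<and> length p = Suc (hamming n u v)"
  using assms
proof (induction "hamming n u v" arbitrary: u)
  case 0
  then have "{i. i < n \<and> u i \<noteq> v i} = {}"
    by (simp add: hamming_def)
  then have "u j = v j" for j
    using 0
    by (cases "j < n") (auto simp: hypercube_def cartesian_product_def PiE_def extensional_def)
  then have "u = v" by blast
  then have "walk (hypercube n) u [u] v"
    using 0 by (simp add: walk_def)
  then show ?case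
    using 0 by (intro exI[of _ "[u]"]) simp
next
  case (Suc m)
  have "{i. i < n \<and> u i \<noteq> v i} \<noteq> {}"
    using Suc.hyps(2) unfolding hamming_def by (metis card.empty nat.distinct(1))
  then obtain i where i: "i < n" "u i \<noteq> v i" by blast
  \<comment> \<open>\<open>hamming_flip\<close> changes the second argument, so it is applied with
    \<open>u\<close> and \<open>v\<close> exchanged.\<close>
  have h: "hamming n u v = Suc (hamming n (flip i u) v)"
    using hamming_flip[of i n v u] i by (simp add: hamming_commute)
  with Suc i obtain p where p: "walk (hypercube n) (flip i u) p v"
    and l: "length p = hamming n u v"
    by (metis flip_in_verts nat.inject)
  have "{(u # p) ! j, (u # p) ! Suc j} \<in> edges (hypercube n)" if "Suc j < length (u # p)" for j
  proof (cases j)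
    case 0
    then show ?thesis
      using p i(1) Suc.prems(1) unfolding edges_hypercube
      by (auto simp: walk_def hd_conv_nth intro!: exI[of _ u] exI[of _ i])
  next
    case (Suc j')
    then show ?thesis
      using p that by (simp add: walk_def)
  qed
  then have "walk (hypercube n) u (u # p) v"
    using p Suc.prems by (simp add: walk_def)
  then show ?case
    using l by (intro exI[of _ "u # p"]) simp
qed

lemma graph_dist_hypercube:
  assumes "u \<in> verts (hypercube n)" "v \<in> verts (hypercube n)"
  shows "graph_dist (hypercube n) u v = enat (hamming n u v)"
proof (rule antisym)
  obtain p where "walk (hypercube n) u p v" "length p = Suc (hamming n u v)"
    using ex_walk_hamming[OF assms] by blast
  then show "graph_dist (hypercube n) u v \<le> enat (hamming n u v)"
    unfolding graph_dist_def by (intro INF_lower2[of p]) auto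
  show "enat (hamming n u v) \<le> graph_dist (hypercube n) u v"
    unfolding graph_dist_def by (intro INF_greatest) (auto dest: hamming_le_walk)
qed

section \<open>Distances between edges\<close>

lemma edge_dist_hypercube_iff:
  assumes "e \<in> edges (hypercube n)" "e' \<in> edges (hypercube n)"
  shows "edge_dist (hypercube n) e e' = enat k \<longleftrightarrow>
    (\<exists>u\<in>e. \<exists>v\<in>e'. hamming n u v = k) \<and> (\<forall>u\<in>e. \<forall>v\<in>e'. k \<le> hamming n u v)"
proof -
  let ?S = "{graph_dist (hypercube n) u v | u v. u \<in> e \<and> v \<in> e'}"
  have e: "finite e" "e \<noteq> {}" "e \<subseteq> verts (hypercube n)"
    and e': "finite e'" "e' \<noteq> {}" "e' \<subseteq> verts (hypercube n)"
    using assms flip_in_verts by (auto simp: edges_hypercube)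
  have S: "?S = (\<lambda>(u, v). enat (hamming n u v)) ` (e \<times> e')"
  proof -
    have "?S = (\<lambda>(u, v). graph_dist (hypercube n) u v) ` (e \<times> e')" by auto
    also have "\<dots> = (\<lambda>(u, v). enat (hamming n u v)) ` (e \<times> e')"
      using e e' by (intro image_cong) (auto simp: subset_iff graph_dist_hypercube)
    finally show ?thesis .
  qed
  have "edge_dist (hypercube n) e e' = enat k \<longleftrightarrow> enat k \<in> ?S \<and> (\<forall>x\<in>?S. enat k \<le> x)"
    unfolding edge_dist_def S using e e' by (intro Min_eq_iff) auto
  then show ?thesis
    unfolding S by auto
qed

text \<open>Guarantees that the maximum defining \<open>max_spread\<close> ranges over a nonempty
  set.\<close>

lemma ex_edges_at_dist:
  assumes "k < n"
  shows "\<exists>e\<in>edges (hypercube n). \<exists>e'\<in>edges (hypercube n). edge_dist (hypercube n) e e' = enat k"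
proof -
  let ?u = "\<lambda>i\<in>{..<n}. False"
  let ?v = "\<lambda>i\<in>{..<n}. i < k"
  have V: "?u \<in> verts (hypercube n)" "?v \<in> verts (hypercube n)"
    by (auto simp: hypercube_def cartesian_product_def K2_def)
  have E: "{?u, flip k ?u} \<in> edges (hypercube n)" "{?v, flip k ?v} \<in> edges (hypercube n)"
    using V assms by (auto simp: edges_hypercube)
  have uv: "hamming n ?u ?v = k"
  proof -
    have "{i. i < n \<and> ?u i \<noteq> ?v i} = {..<k}" using assms by auto
    then show ?thesis by (simp add: hamming_def)
  qed
  \<comment> \<open>Both edges have direction \<open>k\<close>, so passing to their other ends
    leaves the \<open>k\<close> differing coordinates below \<open>k\<close> untouched.\<close>
  have "k \<le> hamming n x y" if "x \<in> {?u, flip k ?u}" "y \<in> {?v, flip k ?v}" for x y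
  proof -
    have "{..<k} \<subseteq> {i. i < n \<and> x i \<noteq> y i}"
      using that assms by (auto simp: flip_def)
    then have "card {..<k} \<le> hamming n x y"
      unfolding hamming_def by (intro card_mono) auto
    then show ?thesis by simp
  qed
  with uv show ?thesis
    by (intro bexI[OF _ E(1)] bexI[OF _ E(2)]) (auto simp: edge_dist_hypercube_iff[OF E])
qed

section \<open>Colors at a vertex and the passage to a closer edge\<close>

text \<open>All of \<open>S\<close> lies between \<open>a\<close> and \<open>Max S\<close>, which
  forces \<open>Max S\<close> up to at least \<open>a + card S - 1\<close>, while \<open>c\<close>
  is at most \<open>b\<close>; \<open>Min S\<close> is symmetric. The additive form avoids truncated
  subtraction.\<close>

lemma subset_interval_near:
  fixes S :: "nat set"
  assumes "S \<subseteq> {a..b}" "S \<noteq> {}" "c \<in> {a..b}"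
  shows "\<exists>s\<in>S. c + card S \<le> s + card {a..b}"
    and "\<exists>s\<in>S. s + card S \<le> c + card {a..b}"
proof -
  have fin: "finite S" using assms(1) finite_subset by blast
  have "card S \<le> card {a..Max S}"
    using assms fin by (intro card_mono) auto
  moreover have "Max S \<in> S" using fin assms by simp
  moreover have "a \<le> Max S" using \<open>Max S \<in> S\<close> assms by auto
  ultimately show "\<exists>s\<in>S. c + card S \<le> s + card {a..b}"
    using assms by (intro bexI[of _ "Max S"]) auto
  have "card S \<le> card {Min S..b}"
    using assms fin by (intro card_mono) auto
  moreover have "Min S \<in> S" using fin assms by simp
  moreover have "Min S \<le> b" using \<open>Min S \<in> S\<close> assms by auto
  ultimately show "\<exists>s\<in>S. s + card S \<le> c + card {a..b}"
    using assms by (intro bexI[of _ "Min S"]) auto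
qed

lemma ex_closer_edge_spread:
  assumes col: "interval_coloring (hypercube n) t \<alpha>"
    and e: "e \<in> edges (hypercube n)" and e': "e' \<in> edges (hypercube n)"
    and dist: "edge_dist (hypercube n) e e' = enat (Suc m)"
  shows "\<exists>f\<in>edges (hypercube n). edge_dist (hypercube n) e f = enat m \<and>
    spread \<alpha> e e' \<le> spread \<alpha> e f + (int n - int (Suc m))"
proof -
  obtain u v where u: "u \<in> e" and v: "v \<in> e'" and uv: "hamming n u v = Suc m"
    and far: "\<And>x y. x \<in> e \<Longrightarrow> y \<in> e' \<Longrightarrow> Suc m \<le> hamming n x y"
    using dist unfolding edge_dist_hypercube_iff[OF e e'] by blast
  have V: "v \<in> verts (hypercube n)"
    using e' v flip_in_verts by (auto simp: edges_hypercube)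
  \<comment> \<open>\<open>D\<close> holds the directions in which \<open>v\<close> can move closer
    to \<open>u\<close>, and \<open>F\<close> the corresponding edges at \<open>v\<close>.\<close>
  define D where "D = {i. i < n \<and> u i \<noteq> v i}"
  define F where "F = (\<lambda>i. {v, flip i v}) ` D"
  have F_incident: "F \<subseteq> incident_edges (hypercube n) v"
    by (auto simp: F_def D_def incident_edges_hypercube[OF V])
  have F_dist: "edge_dist (hypercube n) e f = enat m" if f: "f \<in> F" for f
  proof -
    from f obtain i where i: "i < n" "u i \<noteq> v i" and f_eq: "f = {v, flip i v}"
      by (auto simp: F_def D_def)
    have fE: "f \<in> edges (hypercube n)"
      using f F_incident by (auto simp: incident_edges_def)
    have "hamming n u (flip i v) = m"
      using hamming_flip[of i n u v] i uv by simp
    \<comment> \<open>No end of \<open>e\<close> is closer: each is at least \<open>Suc m\<close>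
      from \<open>v\<close>, and one flip lowers this by at most one.\<close>
    moreover have "m \<le> hamming n x v" "m \<le> hamming n x (flip i v)" if "x \<in> e" for x
      using far[OF that v] hamming_flip_le[of n x v i] by auto
    ultimately show ?thesis
      using u unfolding edge_dist_hypercube_iff[OF e fE] by (auto simp: f_eq)
  qed
  obtain a b where inj: "inj_on \<alpha> (incident_edges (hypercube n) v)"
    and ab: "\<alpha> ` incident_edges (hypercube n) v = {a..b}"
    using col V unfolding interval_coloring_def by blast
  \<comment> \<open>The \<open>n\<close> edges at \<open>v\<close> have distinct colors, so their
    interval of colors has exactly \<open>n\<close> elements.\<close>
  have card_ab: "card {a..b} = n"
    unfolding ab[symmetric] by (simp add: card_image[OF inj] card_incident_edges_hypercube[OF V])
  have "card F = Suc m"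
    using uv by (simp add: F_def D_def hamming_def card_image inj_flip_edge)
  then have card_F: "card (\<alpha> ` F) = Suc m"
    by (simp add: card_image inj_on_subset[OF inj F_incident])
  have sub: "\<alpha> ` F \<subseteq> {a..b}" "\<alpha> ` F \<noteq> {}" "\<alpha> e' \<in> {a..b}"
    using F_incident card_F e' v by (auto simp: ab[symmetric] incident_edges_def)
  have "\<exists>f\<in>F. spread \<alpha> e e' \<le> spread \<alpha> e f + (int n - int (Suc m))"
  \<comment> \<open>The replacement for \<open>e'\<close> should not have a color much nearer to
    that of \<open>e\<close>: a large color in \<open>F\<close> is wanted if \<alpha>(e) lies below
    \<alpha>(e'), a small one otherwise.\<close>
  proof (cases "\<alpha> e \<le> \<alpha> e'")
    case True
    obtain f where "f \<in> F" "\<alpha> e' + Suc m \<le> \<alpha> f + n"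
      using subset_interval_near(1)[OF sub] unfolding card_F card_ab by blast
    then show ?thesis
      using True by (intro bexI[of _ f]) (auto simp: spread_def)
  next
    case False
    obtain f where "f \<in> F" "\<alpha> f + Suc m \<le> \<alpha> e' + n"
      using subset_interval_near(2)[OF sub] unfolding card_F card_ab by blast
    then show ?thesis
      using False by (intro bexI[of _ f]) (auto simp: spread_def)
  qed
  then show ?thesis
    using F_dist F_incident by (auto simp: incident_edges_def)
qed

theorem theorem19:
  fixes n k :: nat and \<alpha> :: "(nat \<Rightarrow> bool) set \<Rightarrow> nat"
  assumes "n \<ge> 2"
    and "interval_coloring (hypercube n) (W (hypercube n)) \<alpha>"
    and "1 \<le> k" and "k \<le> n - 1"
  shows "max_spread (hypercube n) \<alpha> k \<le> max_spread (hypercube n) \<alpha> (k - 1) + (int n - int k)"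
proof -
  let ?G = "hypercube n"
  let ?S = "\<lambda>k. {spread \<alpha> e e' | e e'. e \<in> edges ?G \<and> e' \<in> edges ?G \<and> edge_dist ?G e e' = enat k}"
  obtain m where k: "k = Suc m"
    using assms(3) by (cases k) auto
  \<comment> \<open>Finiteness is needed at both distances: for \<open>k\<close> to bound the
    maximum elementwise, for \<open>m\<close> to place a spread below it.\<close>
  have fin: "finite (?S j)" for j
    by (rule finite_subset[of _ "(\<lambda>(e, e'). spread \<alpha> e e') ` (edges ?G \<times> edges ?G)"])
      (auto simp: finite_edges_hypercube)
  have "?S k \<noteq> {}"
    using ex_edges_at_dist[of k n] assms by fastforce
  moreover have "s \<le> Max (?S m) + (int n - int k)" if "s \<in> ?S k" for s
  proof -
    from that obtain e e' where s: "s = spread \<alpha> e e'" and e: "e \<in> edges ?G"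
      and "e' \<in> edges ?G" "edge_dist ?G e e' = enat (Suc m)"
      unfolding k by blast
    then obtain f where f: "f \<in> edges ?G" "edge_dist ?G e f = enat m"
      and le: "spread \<alpha> e e' \<le> spread \<alpha> e f + (int n - int k)"
      using ex_closer_edge_spread[OF assms(2)] unfolding k by blast
    have "spread \<alpha> e f \<le> Max (?S m)"
      using fin e f by (intro Max_ge) auto
    then show ?thesis
      using le s by simp
  qed
  ultimately show ?thesis
    using fin[of k] by (simp add: max_spread_def k)
qed

end
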